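(* Let $\eta \in [0,2\pi)$ and let $G=(V,\mathcal{A})$ be a mixed cycle of length $n \ge 3$. Then there exists $j \in \{0,1,\dots,n\}$ such that $G$ and $C_n^j$ are $H_\eta$-cospectral. Moreover, for every $j\in\{0,1,\dots,n\}$, \[ \det H_{\eta}(C_n^j) = (-1)^{n+1}\, 2 \cos (\eta j) + (-1)^{\lfloor n/2 \rfloor} (1 + (-1)^n). \]
   Context: A mixed graph $G=(V,\mathcal{A})$ consists of a finite vertex set $V$ and a set of arcs $\mathcal{A}\subseteq (V\times V)\setminus\{(x,x): x\in V\}$. Write $\mathcal{A}^{-1}=\{(y,x):(x,y)\in\mathcal{A}\}$ and $\mathcal{A}^{\pm}=\mathcal{A}\cup\mathcal{A}^{-1}$. The underlying graph $G^{\pm}$ is the simple undirected graph on $V$ with $x,y$ adjacent iff $(x,y)\in\mathcal{A}^{\pm}$; mixed graphs are assumed weakly connected ($G^{\pm}$ connected). A mixed cycle of length $n$ is a mixed graph whose underlying graph is the cycle $C_n$. For $\eta\in[0,2\pi)$, the $\eta$-Hermitian adjacency matrix $H_\eta(G)\in\mathbb{C}^{V\times V}$ has $(x,y)$-entry $1$ if $(x,y)\in\mathcal{A}\cap\mathcal{A}^{-1}$, $e^{\eta i}$ if $(x,y)\in\mathcal{A}\setminus\mathcal{A}^{-1}$, $e^{-\eta i}$ if $(x,y)\in\mathcal{A}^{-1}\setminus\mathcal{A}$, and $0$ otherwise. Two mixed graphs are $H_\eta$-cospectral if their $\eta$-Hermitian adjacency matrices have the same eigenvalues with multiplicities. For $j\in\{0,\dots,n\}$,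 the mixed cycle $C_n^j$ of type $j$ has vertices $x_1,\dots,x_n$ (with $x_{n+1}=x_1$) and arc set $\{(x_i,x_{i+1}):1\le i\le j\}\cup\{(x_i,x_{i+1}),(x_{i+1},x_i): j+1\le i\le n\}$. *)

theory Defs
  imports
    Complex_Main
    "HOL-Combinatorics.Multiset_Permutations"
    "Graph_Theory.Digraph_Component"
    "Graph_Theory.Digraph_Isomorphism"
    "Jordan_Normal_Form.Char_Poly"
begin

text \<open>
  \<^typ>\<open>'a pair_pre_digraph\<close> has a vertex set and a set of ordered pairs as arcs; the locale
  \<^locale>\<open>pair_digraph\<close> says that it is finite, loop-free and that its arcs join its vertices.
  \<^const>\<open>mk_symmetric\<close> is the underlying graph (an undirected graph is represented by its
  symmetric arc relation), and \<^const>\<open>Digraph_Component.connected\<close> is weak connectedness.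
\<close>

definition mixed_graph :: "'a pair_pre_digraph \<Rightarrow> bool" where
  "mixed_graph G \<longleftrightarrow> pair_digraph G \<and> Digraph_Component.connected (with_proj G)"

text \<open>Successor on the cyclically ordered set \<open>{1..n}\<close>, i.e. \<open>x_(n+1) = x_1\<close>.\<close>

definition cyc_succ :: "nat \<Rightarrow> nat \<Rightarrow> nat" where
  "cyc_succ n i = (if i = n then 1 else i + 1)"

definition cycle_graph :: "nat \<Rightarrow> nat pair_pre_digraph" where
  "cycle_graph n =
     \<lparr> pverts = {1..n},
       parcs = {(i, cyc_succ n i) | i. i \<in> {1..n}} \<union> {(cyc_succ n i, i) | i. i \<in> {1..n}} \<rparr>"

definition mixed_cycle :: "'a pair_pre_digraph \<Rightarrow> nat \<Rightarrow> bool" where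
  "mixed_cycle G n \<longleftrightarrow>
     mixed_graph G \<and>
     digraph_iso (with_proj (mk_symmetric (with_proj G))) (with_proj (cycle_graph n))"

definition typed_mixed_cycle :: "nat \<Rightarrow> nat \<Rightarrow> nat pair_pre_digraph" where
  "typed_mixed_cycle n j =
     \<lparr> pverts = {1..n},
       parcs = {(i, cyc_succ n i) | i. i \<in> {1..j}}
             \<union> ({(i, cyc_succ n i) | i. i \<in> {j+1..n}} \<union> {(cyc_succ n i, i) | i. i \<in> {j+1..n}}) \<rparr>"

definition H_entry :: "real \<Rightarrow> 'a pair_pre_digraph \<Rightarrow> 'a \<Rightarrow> 'a \<Rightarrow> complex" where
  "H_entry \<eta> G x y =
     (if (x, y) \<in> parcs G \<inter> (parcs G)\<inverse> then 1
      else if (x, y) \<in> parcs G - (parcs G)\<inverse> then exp (complex_of_real \<eta> * \<i>)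
      else if (x, y) \<in> (parcs G)\<inverse> - parcs G then exp (- complex_of_real \<eta> * \<i>)
      else 0)"

text \<open>
  Matrices in \<^typ>\<open>complex mat\<close> are indexed by numbers, so a \<open>V \<times> V\<close> matrix is written down along
  an enumeration \<open>xs\<close> of \<open>V\<close>, i.e. \<open>xs \<in> permutations_of_set V\<close>.
  Statements about the matrix of a graph quantify over all enumerations of its vertex set.
\<close>

definition H_mat :: "real \<Rightarrow> 'a pair_pre_digraph \<Rightarrow> 'a list \<Rightarrow> complex mat" where
  "H_mat \<eta> G xs = mat (length xs) (length xs) (\<lambda>(i, k). H_entry \<eta> G (xs ! i) (xs ! k))"

text \<open>The eigenvalues with their (algebraic) multiplicities.\<close>

definition eigenvalue_mset :: "complex mat \<Rightarrow> complex multiset" where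
  "eigenvalue_mset A = proots (char_poly A)"

lemma set_mset_eigenvalue_mset:
  assumes "A \<in> carrier_mat n n"
  shows "set_mset (eigenvalue_mset A) = {k. eigenvalue A k}"
proof -
  have "char_poly A \<noteq> 0"
    using degree_monic_char_poly[OF assms] by auto
  then show ?thesis
    unfolding eigenvalue_mset_def by (simp add: eigenvalue_root_char_poly[OF assms])
qed

definition H_cospectral :: "real \<Rightarrow> 'a pair_pre_digraph \<Rightarrow> 'b pair_pre_digraph \<Rightarrow> bool" where
  "H_cospectral \<eta> G G' \<longleftrightarrow>
     (\<forall>xs \<in> permutations_of_set (pverts G). \<forall>ys \<in> permutations_of_set (pverts G').
        eigenvalue_mset (H_mat \<eta> G xs) = eigenvalue_mset (H_mat \<eta> G' ys))"

end

theory Submission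
  imports Defs
begin

text \<open>
  Conjugation by a diagonal unitary matrix moves all weights of a mixed cycle onto a single edge,
  which then carries \<open>w = cis (\<eta> * k)\<close>, where \<open>k\<close> is the number of forward arcs minus the number of
  backward arcs along the cycle. Transposition replaces \<open>w\<close> by \<open>inverse w\<close>, so the spectrum depends
  only on \<open>\<bar>k\<bar>\<close>, and for the cycle of type \<open>j\<close> one has \<open>k = j\<close>. The determinant of the normal form
  follows by eliminating two neighbouring vertices at a time: each such step changes the sign of the
  determinant and of \<open>w\<close>.
\<close>

section \<open>Similarity by monomial matrices\<close>

text \<open>The conjugating matrix is the monomial matrix \<open>P\<close> with entry
  \<open>d i\<close> at position \<open>(i, p i)\<close>. One similarity thus absorbs both an
  arbitrary enumeration of the vertices (through \<open>p\<close>) and the rescaling of the edge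
  weights (through \<open>d\<close>).\<close>

lemma similar_mat_monomial:
  fixes A B :: "'a :: field mat"
  assumes A: "A \<in> carrier_mat n n" and B: "B \<in> carrier_mat n n"
    and p: "p permutes {..<n}"
    and d: "\<And>i. i < n \<Longrightarrow> d i \<noteq> 0"
    and AB: "\<And>i k. i < n \<Longrightarrow> k < n \<Longrightarrow> B $$ (i, k) = d i * A $$ (p i, p k) / d k"
  shows "similar_mat A B"
proof -
  define P where "P = mat n n (\<lambda>(i, k). if k = p i then d i else 0)"
  define Q where "Q = mat n n (\<lambda>(i, k). if i = p k then inverse (d k) else 0)"
  have PQ_carrier: "P \<in> carrier_mat n n" "Q \<in> carrier_mat n n"
    by (auto simp: P_def Q_def)
  have p_less: "p i < n" if "i < n" for i
    using permutes_in_image[OF p, of i] that by simp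
  have p_eq: "p i = p k \<longleftrightarrow> i = k" for i k
    using permutes_inj[OF p] by (auto dest: injD)
  have PQ: "P * Q = 1\<^sub>m n"
  proof (rule eq_matI)
    fix i k assume "i < dim_row (1\<^sub>m n :: 'a mat)" and "k < dim_col (1\<^sub>m n :: 'a mat)"
    then have ik: "i < n" "k < n" by auto
    have "(P * Q) $$ (i, k) =
        (\<Sum>m\<in>{0..<n}. if m = p i then d i * (if m = p k then inverse (d k) else 0) else 0)"
      using ik by (simp add: P_def Q_def scalar_prod_def if_distrib[of "\<lambda>x. x * _"] cong: if_cong)
    also have "\<dots> = 1\<^sub>m n $$ (i, k)"
      using ik p_less[of i] d[of i] by (auto simp: p_eq)
    finally show "(P * Q) $$ (i, k) = 1\<^sub>m n $$ (i, k)" .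
  qed (auto simp: P_def Q_def)
  have QP: "Q * P = 1\<^sub>m n"
    using mat_mult_left_right_inverse[OF PQ_carrier PQ] .
  have "B = P * A * Q"
  proof (rule eq_matI)
    fix i k assume "i < dim_row (P * A * Q)" and "k < dim_col (P * A * Q)"
    then have ik: "i < n" "k < n" by (auto simp: P_def Q_def)
    have PA: "(P * A) $$ (i, m) = d i * A $$ (p i, m)" if "m < n" for m
    proof -
      have "(P * A) $$ (i, m) = (\<Sum>l\<in>{0..<n}. if l = p i then d i * A $$ (l, m) else 0)"
        using ik that A by (simp add: P_def scalar_prod_def if_distrib[of "\<lambda>x. x * _"] cong: if_cong)
      then show ?thesis using ik p_less by simp
    qed
    have "(P * A * Q) $$ (i, k) = (\<Sum>m\<in>{0..<n}. (P * A) $$ (i, m) * Q $$ (m, k))"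
      using ik A PQ_carrier by (simp add: scalar_prod_def del: assoc_mult_mat)
    also have "\<dots> = (\<Sum>m\<in>{0..<n}. if m = p k then d i * A $$ (p i, m) * inverse (d k) else 0)"
      by (rule sum.cong) (use ik in \<open>auto simp: PA Q_def simp del: index_mult_mat(1)\<close>)
    also have "\<dots> = B $$ (i, k)"
      using ik p_less AB by (simp add: field_simps)
    finally show "B $$ (i, k) = (P * A * Q) $$ (i, k)" ..
  qed (use A B in \<open>auto simp: P_def Q_def\<close>)
  then have "similar_mat B A"
    using A B PQ_carrier PQ QP by (intro similar_matI[of _ _ P Q n]) auto
  then show ?thesis by (rule similar_mat_sym)
qed

section \<open>Normal form of a cycle and its determinant\<close>

lemma det_2:
  fixes A :: "'a :: comm_ring_1 mat"
  assumes A: "A \<in> carrier_mat 2 2"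
  shows "det A = A $$ (0, 0) * A $$ (1, 1) - A $$ (0, 1) * A $$ (1, 0)"
proof -
  have single: "det (mat_delete A 0 k) = mat_delete A 0 k $$ (0, 0)" if "k < 2" for k
    using mat_delete_carrier[OF A, of 0 k] by (intro det_single) simp
  have "det A = (\<Sum>k<2. A $$ (0, k) * cofactor A 0 k)"
    using laplace_expansion_row[OF A, of 0] by simp
  also have "\<dots> = A $$ (0, 0) * A $$ (1, 1) - A $$ (0, 1) * A $$ (1, 0)"
    using A single[of 0] single[of 1] by (simp add: numeral_2_eq_2 cofactor_def mat_delete_def)
  finally show ?thesis .
qed

text \<open>The four summands overlap for \<open>n \<le> 2\<close>; adding them up makes the recurrence
  \<open>det_twisted_cycle_mat_step\<close> valid down to these sizes.\<close>

definition twisted_cycle_mat :: "nat \<Rightarrow> 'a :: field \<Rightarrow> 'a mat" where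
  "twisted_cycle_mat n w = mat n n (\<lambda>(i, k).
     (if k = Suc i then 1 else 0) + (if i = Suc k then 1 else 0)
     + (if i = n - 1 \<and> k = 0 then w else 0) + (if i = 0 \<and> k = n - 1 then inverse w else 0))"

lemma twisted_cycle_mat_carrier [simp]: "twisted_cycle_mat n w \<in> carrier_mat n n"
  by (simp add: twisted_cycle_mat_def)

text \<open>Transposition swaps the two corner entries and fixes the rest, so \<open>w\<close> and
  \<open>inverse w\<close> give the same characteristic polynomial.\<close>

lemma transpose_twisted_cycle_mat:
  "transpose_mat (twisted_cycle_mat n w) = twisted_cycle_mat n (inverse w)"
  by (rule eq_matI) (auto simp: twisted_cycle_mat_def)

text \<open>Schur complement of the last two vertices, whose block is the involution with determinant \<open>-1\<close>.\<close>

lemma det_twisted_cycle_mat_step: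
  fixes w :: "'a :: field"
  assumes "m \<ge> 1"
  shows "det (twisted_cycle_mat (m + 2) w) = - det (twisted_cycle_mat m (- w))"
proof -
  define A :: "'a mat" where
    "A = mat m m (\<lambda>(i, k). (if k = Suc i then 1 else 0) + (if i = Suc k then 1 else 0))"
  define B :: "'a mat" where
    "B = mat m 2 (\<lambda>(i, k). if k = 0 then (if i = m - 1 then 1 else 0) else (if i = 0 then inverse w else 0))"
  define C :: "'a mat" where
    "C = mat 2 m (\<lambda>(i, k). if i = 0 then (if k = m - 1 then 1 else 0) else (if k = 0 then w else 0))"
  define D :: "'a mat" where "D = mat 2 2 (\<lambda>(i, k). if i = k then 0 else 1)"
  \<comment> \<open>\<open>E\<close> is \<open>- D * C\<close>; since \<open>D\<close> is its own
    inverse, this solves \<open>C + D * E = 0\<close>, and column operations with \<open>E\<close>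
    clear the lower left block.\<close>
  define E :: "'a mat" where
    "E = mat 2 m (\<lambda>(i, k). if i = 1 then (if k = m - 1 then - 1 else 0) else (if k = 0 then - w else 0))"
  have carrier [simp]: "A \<in> carrier_mat m m" "B \<in> carrier_mat m 2" "C \<in> carrier_mat 2 m"
    "D \<in> carrier_mat 2 2" "E \<in> carrier_mat 2 m"
    by (simp_all add: A_def B_def C_def D_def E_def)
  have split: "twisted_cycle_mat (m + 2) w = four_block_mat A B C D"
    by (rule eq_matI) (use assms in \<open>auto simp: twisted_cycle_mat_def A_def B_def C_def D_def\<close>)
  have schur: "A + B * E = twisted_cycle_mat m (- w)"
    by (rule eq_matI) (use assms in \<open>auto simp: twisted_cycle_mat_def A_def B_def E_def
      scalar_prod_def numeral_2_eq_2 split: if_splits\<close>)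
  have CDE: "C + D * E = 0\<^sub>m 2 m"
    by (rule eq_matI) (auto simp: C_def D_def E_def scalar_prod_def numeral_2_eq_2 less_Suc_eq)
  have "four_block_mat A B C D * four_block_mat (1\<^sub>m m) (0\<^sub>m m 2) E (1\<^sub>m 2)
      = four_block_mat (A * 1\<^sub>m m + B * E) (A * 0\<^sub>m m 2 + B * 1\<^sub>m 2)
          (C * 1\<^sub>m m + D * E) (C * 0\<^sub>m m 2 + D * 1\<^sub>m 2)"
    by (rule mult_four_block_mat[of _ m m _ 2 _ 2 _ _ m _ 2]) auto
  also have "\<dots> = four_block_mat (twisted_cycle_mat m (- w)) B (0\<^sub>m 2 m) D"
    using schur CDE by (simp add: right_mult_one_mat[of _ m m] right_mult_one_mat[of _ m 2]
      right_mult_one_mat[of _ 2 m] right_mult_one_mat[of _ 2 2]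
      right_mult_zero_mat[of _ m m] right_mult_zero_mat[of _ 2 m])
  finally have "det (four_block_mat A B C D) * det (four_block_mat (1\<^sub>m m) (0\<^sub>m m 2) E (1\<^sub>m 2))
      = det (four_block_mat (twisted_cycle_mat m (- w)) B (0\<^sub>m 2 m) D)"
    by (subst det_mult[symmetric, OF four_block_carrier_mat four_block_carrier_mat]) auto
  moreover have "det (four_block_mat (1\<^sub>m m) (0\<^sub>m m 2) E (1\<^sub>m 2)) = 1"
    by (subst det_four_block_mat_upper_right_zero[of _ m _ 2]) auto
  moreover have "det (four_block_mat (twisted_cycle_mat m (- w)) B (0\<^sub>m 2 m) D)
      = det (twisted_cycle_mat m (- w)) * det D"
    by (rule det_four_block_mat_lower_left_zero[of _ m _ 2]) auto
  moreover have "det D = - 1"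
    by (subst det_2) (auto simp: D_def)
  ultimately show ?thesis unfolding split by simp
qed

text \<open>The formula obeys the same recurrence: passing from \<open>m\<close> to
  \<open>m + 2\<close> keeps the first sign, so negating \<open>w\<close> cancels the outer minus
  there; in the second term \<open>n div 2\<close> grows by one, which cancels it too.\<close>

lemma det_twisted_cycle_mat:
  fixes w :: "'a :: field"
  assumes "n \<ge> 1" and "w \<noteq> 0"
  shows "det (twisted_cycle_mat n w) =
    (-1) ^ (n + 1) * (w + inverse w) + (-1) ^ (n div 2) * (1 + (-1) ^ n)"
  using assms
proof (induction n arbitrary: w rule: less_induct)
  case (less n)
  consider "n = 1" | "n = 2" | m where "n = m + 2" "m \<ge> 1"
    using less.prems(1) that(3)[of "n - 2"] by fastforce
  then show ?case
  proof cases
    case 1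
    then show ?thesis by (simp add: det_single twisted_cycle_mat_def)
  next
    case 2
    \<comment> \<open>For two vertices the closing edge is parallel to the path edge, so each
      off-diagonal entry is a sum.\<close>
    have "det (twisted_cycle_mat 2 w) = - ((1 + w) * (1 + inverse w))"
      by (subst det_2) (auto simp: twisted_cycle_mat_def)
    with 2 less.prems show ?thesis by (simp add: field_simps)
  next
    case 3
    then have "det (twisted_cycle_mat n w) = - det (twisted_cycle_mat m (- w))"
      using det_twisted_cycle_mat_step by blast
    with less.IH[of m "- w"] 3 less.prems show ?thesis by (simp add: algebra_simps)
  qed
qed


section \<open>Winding number and reduction to the normal form\<close>

text \<open>The exponent of the edge weight. It is 0 both for two-way edges and for non-adjacent
  pairs, so adjacency has to be tested separately.\<close>

definition arc_sign :: "'a pair_pre_digraph \<Rightarrow> 'a \<Rightarrow> 'a \<Rightarrow> int" where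
  "arc_sign G x y = of_bool ((x, y) \<in> parcs G) - of_bool ((y, x) \<in> parcs G)"

lemma H_entry_eq_cis_arc_sign:
  "H_entry \<eta> G x y =
    (if (x, y) \<in> parcs G \<union> (parcs G)\<inverse> then cis (\<eta> * of_int (arc_sign G x y)) else 0)"
  by (auto simp: H_entry_def arc_sign_def cis_conv_exp mult.commute)

text \<open>Common interface to arbitrary mixed cycles and to those of type \<open>j\<close>. Labels
  start at 0 to agree with matrix indices.\<close>

definition cyclic_labelling :: "'a pair_pre_digraph \<Rightarrow> nat \<Rightarrow> (nat \<Rightarrow> 'a) \<Rightarrow> bool" where
  "cyclic_labelling G n z \<longleftrightarrow> bij_betw z {..<n} (pverts G) \<and>
     (\<forall>i<n. \<forall>k<n. (z i, z k) \<in> parcs G \<union> (parcs G)\<inverse> \<longleftrightarrow> k = Suc i mod n \<or> i = Suc k mod n)"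

definition winding :: "'a pair_pre_digraph \<Rightarrow> nat \<Rightarrow> (nat \<Rightarrow> 'a) \<Rightarrow> int" where
  "winding G n z = (\<Sum>i<n. arc_sign G (z i) (z (Suc i mod n)))"

text \<open>Scaling the vertex \<open>z i\<close> by the product of the weights along the path from \<open>z 0\<close> to \<open>z i\<close>
  turns all weights into 1, except the one on the edge that closes the cycle.\<close>

lemma similar_H_mat_twisted_cycle_mat:
  assumes n: "n \<ge> 3" and z: "cyclic_labelling G n z" and xs: "xs \<in> permutations_of_set (pverts G)"
  shows "similar_mat (H_mat \<eta> G xs) (twisted_cycle_mat n (cis (\<eta> * of_int (winding G n z))))"
proof -
  have bij: "bij_betw z {..<n} (pverts G)"
    and adj: "\<And>i k. i < n \<Longrightarrow> k < n \<Longrightarrow>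
      (z i, z k) \<in> parcs G \<union> (parcs G)\<inverse> \<longleftrightarrow> k = Suc i mod n \<or> i = Suc k mod n"
    using z by (auto simp: cyclic_labelling_def)
  have xs': "set xs = pverts G" "distinct xs"
    using permutations_of_setD[OF xs] by auto
  have len: "length xs = n"
    using bij_betw_same_card[OF bij] distinct_card[OF xs'(2)] xs'(1) by simp
  have "distinct (map z [0..<n])"
    using bij by (simp add: distinct_map bij_betw_def atLeast0LessThan)
  moreover have "set (map z [0..<n]) = pverts G"
    using bij by (simp add: bij_betw_def atLeast0LessThan)
  \<comment> \<open>Two repetition-free lists of the same vertices differ by a permutation, which
    becomes the \<open>p\<close> of the monomial similarity.\<close>
  ultimately have "mset (map z [0..<n]) = mset xs"
    using xs' by (metis set_eq_iff_mset_eq_distinct)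
  then obtain p where p: "p permutes {..<length xs}" and "permute_list p xs = map z [0..<n]"
    by (rule mset_eq_permutation)
  then have p_nth: "xs ! p i = z i" if "i < n" for i
    using that len by (metis permute_list_nth nth_map_upt add_0 diff_zero)
  have p_less: "p i < n" if "i < n" for i
    using permutes_in_image[OF p, of i] that len by simp
  define a where "a i = cis (\<eta> * of_int (arc_sign G (z i) (z (Suc i mod n))))" for i
  define d where "d i = (\<Prod>m<i. a m)" for i
  have a_nonzero: "a i \<noteq> 0" for i
    by (simp add: a_def)
  then have d_nonzero: "d i \<noteq> 0" for i
    by (simp add: d_def)
  have entry_succ: "H_entry \<eta> G (z i) (z (Suc i mod n)) = a i" if "i < n" for i
    using adj[of i "Suc i mod n"] that n by (simp add: H_entry_eq_cis_arc_sign a_def)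
  have entry_pred: "H_entry \<eta> G (z (Suc i mod n)) (z i) = inverse (a i)" if "i < n" for i
  proof -
    have "arc_sign G (z (Suc i mod n)) (z i) = - arc_sign G (z i) (z (Suc i mod n))"
      by (simp add: arc_sign_def)
    then show ?thesis
      using adj[of "Suc i mod n" i] that n by (simp add: H_entry_eq_cis_arc_sign a_def cis_inverse)
  qed
  have d_n: "cis (\<eta> * of_int (winding G n z)) = d n"
  proof -
    have "cis (\<eta> * of_int (\<Sum>i<k. arc_sign G (z i) (z (Suc i mod n)))) = d k" for k
      by (induction k) (simp_all add: d_def a_def cis_mult[symmetric] algebra_simps)
    then show ?thesis by (simp add: winding_def)
  qed
  have d_Suc: "d (Suc i) = d i * a i" for i
    by (simp add: d_def)
  have d_last: "d n = d (n - 1) * a (n - 1)"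
    using d_Suc[of "n - 1"] n by simp
  show ?thesis
  proof (rule similar_mat_monomial[where p = p and d = d])
    show "H_mat \<eta> G xs \<in> carrier_mat n n"
      by (simp add: H_mat_def len)
    show "p permutes {..<n}"
      using p len by simp
    fix i k assume ik: "i < n" "k < n"
    have "H_mat \<eta> G xs $$ (p i, p k) = H_entry \<eta> G (z i) (z k)"
      using ik p_less by (simp add: H_mat_def len p_nth)
    \<comment> \<open>Path edges and the closing edge, each in both directions, then non-adjacent
      pairs. As \<open>n \<ge> 3\<close>, the first four cases exclude each other, so just one
      summand of the normal form survives in each.\<close>
    moreover consider "k = Suc i" | "i = Suc k" | "i = n - 1" "k = 0" | "i = 0" "k = n - 1"
      | "k \<noteq> Suc i mod n" "i \<noteq> Suc k mod n"
      using ik n by (cases "Suc i = n"; cases "Suc k = n") force+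
    then have "twisted_cycle_mat n (d n) $$ (i, k) = d i * H_entry \<eta> G (z i) (z k) / d k"
    proof cases
      case 1
      then show ?thesis
        using ik n entry_succ[of i] a_nonzero[of i] d_nonzero[of i]
        by (auto simp: twisted_cycle_mat_def d_Suc)
    next
      case 2
      then show ?thesis
        using ik n entry_pred[of k] a_nonzero[of k] d_nonzero[of k]
        by (auto simp: twisted_cycle_mat_def d_Suc)
    next
      \<comment> \<open>Since \<open>d 0 = 1\<close>, the scaled closing entry is
        \<open>d (n - 1) * a (n - 1) = d n\<close>; the opposite direction gives its
        inverse.\<close>
      case 3
      then show ?thesis
        using ik n entry_succ[of i]
        by (simp add: twisted_cycle_mat_def d_last) (simp add: d_def)
    next
      case 4
      then show ?thesis
        using ik n entry_pred[of k]
        by (simp add: twisted_cycle_mat_def d_last) (simp add: d_def field_simps)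
    next
      case 5
      have "H_entry \<eta> G (z i) (z k) = 0"
        using adj[of i k] ik 5 by (simp add: H_entry_eq_cis_arc_sign)
      then show ?thesis
        using ik n 5 by (auto simp: twisted_cycle_mat_def mod_Suc split: if_splits)
    qed
    ultimately show "twisted_cycle_mat n (cis (\<eta> * of_int (winding G n z))) $$ (i, k)
        = d i * H_mat \<eta> G xs $$ (p i, p k) / d k"
      by (simp add: d_n)
  qed (auto simp: d_nonzero)
qed

text \<open>The enumeration \<open>xs\<close> is absent from the right-hand side, so this covers all
  enumerations at once. The absolute value makes the exponent comparable with a type
  \<open>j\<close>.\<close>

lemma eigenvalue_mset_H_mat:
  assumes "n \<ge> 3" and "cyclic_labelling G n z" and "xs \<in> permutations_of_set (pverts G)"
  shows "eigenvalue_mset (H_mat \<eta> G xs) =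
    eigenvalue_mset (twisted_cycle_mat n (cis (\<eta> * of_int \<bar>winding G n z\<bar>)))"
proof -
  have "char_poly (twisted_cycle_mat n (cis (- x))) = char_poly (twisted_cycle_mat n (cis x))" for x
    using char_poly_transpose_mat[of "twisted_cycle_mat n (cis x)" n]
    by (simp add: transpose_twisted_cycle_mat)
  then have "char_poly (twisted_cycle_mat n (cis (\<eta> * of_int \<bar>winding G n z\<bar>))) =
      char_poly (twisted_cycle_mat n (cis (\<eta> * of_int (winding G n z))))"
    by (simp add: abs_if)
  then show ?thesis
    using char_poly_similar[OF similar_H_mat_twisted_cycle_mat[OF assms]]
    by (simp add: eigenvalue_mset_def)
qed

text \<open>Each edge contributes at most 1 in absolute value; hence the absolute winding number is
  an admissible type.\<close>

lemma abs_winding_le: "\<bar>winding G n z\<bar> \<le> int n"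
proof -
  have "\<bar>winding G n z\<bar> \<le> (\<Sum>i<n. \<bar>arc_sign G (z i) (z (Suc i mod n))\<bar>)"
    unfolding winding_def by (rule sum_abs)
  also have "\<dots> \<le> (\<Sum>i<n. 1)"
    by (rule sum_mono) (simp add: arc_sign_def)
  finally show ?thesis by simp
qed

section \<open>Cyclic labellings of mixed cycles and of the typed cycles\<close>

lemma cyc_succ_Suc: "i < n \<Longrightarrow> cyc_succ n (Suc i) = Suc (Suc i mod n)"
  by (auto simp: cyc_succ_def)

lemma bij_betw_Suc_lessThan: "bij_betw Suc {..<n} {1..n}"
  by (simp add: bij_betw_def image_Suc_lessThan)

lemma cycle_graph_arc_iff:
  assumes "i < n" and "k < n"
  shows "(Suc i, Suc k) \<in> parcs (cycle_graph n) \<longleftrightarrow> k = Suc i mod n \<or> i = Suc k mod n"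
  using assms by (auto simp: cycle_graph_def cyc_succ_def mod_Suc)

text \<open>The numbering of the standard cycle is pulled back along the vertex part of the
  isomorphism.\<close>

lemma cyclic_labelling_mixed_cycle:
  assumes "mixed_cycle G n"
  shows "\<exists>z. cyclic_labelling G n z"
proof -
  let ?S = "mk_symmetric (with_proj G)"
  obtain f where f: "pre_digraph.digraph_isomorphism (with_proj ?S) f"
    and eq: "with_proj (cycle_graph n) = app_iso f (with_proj ?S)"
    using assms by (auto simp: mixed_cycle_def digraph_iso_def)
  define g where "g = iso_verts f"
  have parcs_S: "parcs ?S = parcs G \<union> (parcs G)\<inverse>"
    by (auto simp: parcs_mk_symmetric)
  have "pverts (cycle_graph n) = g ` pverts G"
    using arg_cong[OF eq, of verts] by (simp add: g_def)
  moreover have inj: "inj_on g (pverts G)"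
    using pre_digraph.digraph_isomorphism_inj_on_verts[OF f] by (simp add: g_def)
  ultimately have bij: "bij_betw g (pverts G) {1..n}"
    by (simp add: bij_betw_def cycle_graph_def)
  have wf: "wf_digraph (with_proj ?S)"
    using f by (simp add: pre_digraph.digraph_isomorphism_def)
  \<comment> \<open>A digraph isomorphism carries its own arc, tail and head maps. Both graphs here
    have pairs as arcs, so the arc map is determined by the vertex map \<open>g\<close>.\<close>
  have "iso_tail f = fst" "iso_head f = snd"
    using arg_cong[OF eq, of tail] arg_cong[OF eq, of head] by simp_all
  then have "iso_arcs f e = (g (fst e), g (snd e))" if "e \<in> parcs ?S" for e
    using pre_digraph.iso_verts_tail[OF f, of e] pre_digraph.iso_verts_head[OF f, of e] that
    by (simp add: g_def prod_eq_iff)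
  moreover have "parcs (cycle_graph n) = iso_arcs f ` parcs ?S"
    using arg_cong[OF eq, of arcs] by simp
  ultimately have arcs: "parcs (cycle_graph n) = (\<lambda>e. (g (fst e), g (snd e))) ` parcs ?S"
    by (metis (no_types, lifting) image_cong)
  have arc_iff: "(g x, g y) \<in> parcs (cycle_graph n) \<longleftrightarrow> (x, y) \<in> parcs ?S"
    if "x \<in> pverts G" "y \<in> pverts G" for x y
  proof
    assume "(g x, g y) \<in> parcs (cycle_graph n)"
    then obtain u v where uv: "(u, v) \<in> parcs ?S" "g x = g u" "g y = g v"
      unfolding arcs by auto
    \<comment> \<open>Injectivity of \<open>g\<close> is known on vertices only, so the endpoints
      must be shown to be vertices.\<close>
    moreover have "u \<in> pverts G" "v \<in> pverts G"
      using wf_digraph.tail_in_verts[OF wf, of "(u, v)"] wf_digraph.head_in_verts[OF wf, of "(u, v)"]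
        uv(1) by auto
    ultimately show "(x, y) \<in> parcs ?S"
      using inj that by (auto dest: inj_onD)
  next
    assume "(x, y) \<in> parcs ?S"
    then show "(g x, g y) \<in> parcs (cycle_graph n)"
      unfolding arcs by force
  qed
  \<comment> \<open>\<open>Suc\<close> shifts the labels from 0 to \<open>n - 1\<close> onto the
    vertices 1 to \<open>n\<close> of the standard cycle.\<close>
  define z where "z = the_inv_into (pverts G) g \<circ> Suc"
  have z_bij: "bij_betw z {..<n} (pverts G)"
    unfolding z_def using bij_betw_Suc_lessThan bij_betw_the_inv_into[OF bij] by (rule bij_betw_trans)
  have g_z: "g (z i) = Suc i" if "i < n" for i
    unfolding z_def comp_def using that bij
    by (intro f_the_inv_into_f_bij_betw[OF bij]) auto
  have "(z i, z k) \<in> parcs G \<union> (parcs G)\<inverse> \<longleftrightarrow> k = Suc i mod n \<or> i = Suc k mod n"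
    if "i < n" "k < n" for i k
    using arc_iff[of "z i" "z k"] cycle_graph_arc_iff[OF that] g_z that parcs_S
      bij_betwE[OF z_bij] by simp
  then show ?thesis
    using z_bij by (auto simp: cyclic_labelling_def)
qed

text \<open>Forgetting directions turns every type into the same standard cycle.\<close>

lemma cyclic_labelling_typed_mixed_cycle:
  assumes "j \<le> n"
  shows "cyclic_labelling (typed_mixed_cycle n j) n Suc"
proof -
  have "parcs (typed_mixed_cycle n j) \<union> (parcs (typed_mixed_cycle n j))\<inverse> = parcs (cycle_graph n)"
    using assms by (fastforce simp: typed_mixed_cycle_def cycle_graph_def)
  then show ?thesis
    using bij_betw_Suc_lessThan
    by (simp add: cyclic_labelling_def cycle_graph_arc_iff typed_mixed_cycle_def)
qed

lemma winding_typed_mixed_cycle: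
  assumes n: "n \<ge> 3" and j: "j \<le> n"
  shows "winding (typed_mixed_cycle n j) n Suc = int j"
proof -
  have "arc_sign (typed_mixed_cycle n j) (Suc i) (Suc (Suc i mod n)) = of_bool (i < j)"
    if "i < n" for i
  proof -
    have "(Suc i, Suc (Suc i mod n)) \<in> parcs (typed_mixed_cycle n j)"
      using cyc_succ_Suc[OF that] that by (auto simp: typed_mixed_cycle_def)
    \<comment> \<open>For \<open>n \<ge> 3\<close> a reversed step around the cycle is never a
      forward step, so it is an arc only if it comes from the two-way part. Thus exactly the first
      \<open>j\<close> edges have sign 1 and the others sign 0.\<close>
    moreover have "(Suc (Suc i mod n), Suc i) \<in> parcs (typed_mixed_cycle n j) \<longleftrightarrow> j \<le> i"
      using n j that by (auto simp: typed_mixed_cycle_def cyc_succ_def mod_Suc split: if_splits)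
    ultimately show ?thesis
      by (simp add: arc_sign_def)
  qed
  then have "winding (typed_mixed_cycle n j) n Suc = (\<Sum>i<n. of_bool (i < j))"
    by (simp add: winding_def)
  also have "\<dots> = int (card ({..<n} \<inter> {i. i < j}))"
    by (simp add: of_bool_def sum.If_cases)
  also have "{..<n} \<inter> {i. i < j} = {..<j}"
    using j by auto
  finally show ?thesis by simp
qed

theorem theorem1p1:
  fixes \<eta> :: real and G :: "'a pair_pre_digraph" and n :: nat
  assumes "0 \<le> \<eta>" and "\<eta> < 2 * pi"
    and "n \<ge> 3"
    and "mixed_cycle G n"
  shows "(\<exists>j\<in>{0..n}. H_cospectral \<eta> G (typed_mixed_cycle n j)) \<and>
    (\<forall>j\<in>{0..n}. \<forall>xs\<in>permutations_of_set (pverts (typed_mixed_cycle n j)).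
       det (H_mat \<eta> (typed_mixed_cycle n j) xs) =
         (-1) ^ (n + 1) * 2 * complex_of_real (cos (\<eta> * real j)) + (-1) ^ (n div 2) * (1 + (-1) ^ n))"
proof (intro conjI ballI)
  obtain z where z: "cyclic_labelling G n z"
    using cyclic_labelling_mixed_cycle[OF assms(4)] by blast
  define j where "j = nat \<bar>winding G n z\<bar>"
  have j: "j \<le> n"
    using abs_winding_le[of G n z] by (simp add: j_def)
  \<comment> \<open>Both graphs reduce to the normal form with exponent \<open>j\<close>, whatever
    the enumerations of their vertices.\<close>
  have "H_cospectral \<eta> G (typed_mixed_cycle n j)"
    unfolding H_cospectral_def
    using eigenvalue_mset_H_mat[OF assms(3) z]
      eigenvalue_mset_H_mat[OF assms(3) cyclic_labelling_typed_mixed_cycle[OF j]]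
    by (simp add: winding_typed_mixed_cycle[OF assms(3) j]) (simp add: j_def)
  then show "\<exists>j\<in>{0..n}. H_cospectral \<eta> G (typed_mixed_cycle n j)"
    using j by auto
next
  fix j xs
  assume j: "j \<in> {0..n}" and xs: "xs \<in> permutations_of_set (pverts (typed_mixed_cycle n j))"
  let ?w = "cis (\<eta> * real j)"
  have "det (H_mat \<eta> (typed_mixed_cycle n j) xs) = det (twisted_cycle_mat n ?w)"
    using det_similar[OF similar_H_mat_twisted_cycle_mat[OF assms(3)
        cyclic_labelling_typed_mixed_cycle xs]] j
    by (simp add: winding_typed_mixed_cycle[OF assms(3)])
  also have "\<dots> = (-1) ^ (n + 1) * (?w + inverse ?w) + (-1) ^ (n div 2) * (1 + (-1) ^ n)"
    using assms(3) by (intro det_twisted_cycle_mat) auto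
  \<comment> \<open>On the unit circle the inverse is the conjugate, so the sum is twice the real
    part.\<close>
  also have "?w + inverse ?w = 2 * complex_of_real (cos (\<eta> * real j))"
    by (simp add: complex_eq_iff)
  finally show "det (H_mat \<eta> (typed_mixed_cycle n j) xs) =
      (-1) ^ (n + 1) * 2 * complex_of_real (cos (\<eta> * real j)) + (-1) ^ (n div 2) * (1 + (-1) ^ n)"
    by (simp add: mult.assoc)
qed

end
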